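(* Let $(\mathcal A,* )$ be the algebra $\mathcal A=A[[\nu]]$ equipped with the Duflo–Kontsevich star product $*$ of a polynomial Poisson structure on $\mathbb R^d$. The semilinear involution $f\mapsto f^*$ of $\mathcal A$ given by $f^*(\xi)=\overline{f(\overline\xi)}$ (with $\overline\nu=-\nu$) is an anti-automorphism of $(\mathcal A,* )$, i.e. $(f*g)^*=g^**f^*$ for all $f,g\in\mathcal A$. Moreover it restricts to $A$, and its restriction to $A$ is a (semilinear) (anti-)automorphism of the commutative algebra $A$.
   Context: Let $\{\cdot,\cdot\}$ be a Poisson bracket on $\mathbb R^d$ with real polynomial coefficients, $A=\mathbb C[x_1,\dots,x_d]$ the polynomials on $\mathbb C^d$, $\mathcal A=A[[\nu]]$. Complex conjugation is extended to $\mathbb C[[\nu]]$ by $\overline\nu=-\nu$; thus for $f=\sum_k\nu^kf_k\in\mathcal A$, $f^*=\sum_k(-\nu)^kf_k^*$ with $f_k^*(\xi)=\overline{f_k(\overline\xi)}$ for $\xi\in\mathbb C^d$. Kontsevich star product. Put $\alpha^{ij}=\tfrac12\{x_i,x_j\}$. For distinct $p,q$ in the closed upper half-plane, with $p$ in the open half-plane $\mathbb H$, let $\phi(p,q)=\arg\frac{q-p}{q-\overline p}$ (mod $2\pi$). Let $G_n$ be the finite set of oriented graphs with vertices $1,\dots,n,L,R$, such that each vertex $k\in\{1,\dots,n\}$ has exactly two ordered outgoing edges $e_k^1,e_k^2$ ending at distinct vertices different from $k$, and no other edges. For $\Gamma\in G_n$ let $B_\Gamma(f,g)=\sum_{I}\prod_{k=1}^n\Big(\prod_{e\to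 k}\partial_{I(e)}\Big)\alpha^{I(e_k^1)I(e_k^2)}\cdot\Big(\prod_{e\to L}\partial_{I(e)}\Big)f\cdot\Big(\prod_{e\to R}\partial_{I(e)}\Big)g$, summing over all maps $I$ from edges to $\{1,\dots,d\}$, and let $w_\Gamma=\frac1{n!(2\pi)^{2n}}\int\bigwedge_{k=1}^n d\phi_{e_k^1}\wedge d\phi_{e_k^2}$, integrated over configurations of $n$ distinct points $p_1,\dots,p_n\in\mathbb H$ (standard orientation), where $L$ is placed at $0$, $R$ at $1$, and $\phi_e=\phi(p,q)$ for an edge $e$ from the vertex at $p$ to the vertex at $q$. Then $f\#g=\sum_{n\ge0}\nu^n\sum_{\Gamma\in G_n}w_\Gamma B_\Gamma(f,g)$, extended $\mathbb C[[\nu]]$-bilinearly to $\mathcal A$; it is an associative product with $f\#g-g\#f=\nu\{f,g\}+O(\nu^2)$. Duflo–Kontsevich star product. Let $G'_n$ be the set of oriented graphs with vertices $0,1,\dots,n$ such that each $k\in\{1,\dots,n\}$ has exactly two ordered outgoing edges $e_k^1,e_k^2$, ending at distinct vertices different from $k$, and vertex $0$ has no outgoing edge. For $\Gamma\in G'_n$ let $B'_\Gamma(f)=\sum_I\prod_{k=1}^n\Big(\prod_{e\to k}\partial_{I(e)}\Big)\alpha^{I(e_k^1)I(e_k^2)}\cdot\Big(\prod_{e\to0}\partial_{I(e)}\Big)f$ and $w'_\Gamma=\frac1{n!(2\pi)^{2n}}\int\bigwedge_{k=1}^nd\phi_{e_k^1}\wedge d\phi_{e_k^2}$, the integral being over configurations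 of $n$ distinct points of $\mathbb H\setminus\{\sqrt{-1}\}$, the vertex $0$ being placed at $\sqrt{-1}$. The operator $T=\sum_{n\ge0}\nu^n\sum_{\Gamma\in G'_n}w'_\Gamma B'_\Gamma=I+O(\nu)$ is an invertible $\mathbb C[[\nu]]$-linear formal differential operator on $\mathcal A$ (Kontsevich's tangent map). With $D=T^{-1}$, the Duflo–Kontsevich star product is $f*g=D(D^{-1}f\,\#\,D^{-1}g)$. It satisfies $f*g=fg$ for $f,g$ in the center of $(\mathcal A,* )$. *)

theory Defs
  imports
    "HOL-Analysis.Analysis"
    "HOL-Combinatorics.Permutations"
    "HOL-Computational_Algebra.Formal_Power_Series"
    "HOL-Library.Poly_Mapping"
begin

section \<open>Polynomials on complex \<open>d\<close>-space\<close>

text \<open>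
  The variables are indexed by a finite type \<open>'d\<close>, where \<open>d = CARD('d)\<close>; the monoid ring over the
  exponents \<open>'d \<Rightarrow>\<^sub>0 nat\<close> is the polynomial ring \<open>A\<close>.
\<close>

type_synonym 'd mpoly = "('d \<Rightarrow>\<^sub>0 nat) \<Rightarrow>\<^sub>0 complex"

definition pconst :: "complex \<Rightarrow> 'd mpoly" where
  "pconst c = Poly_Mapping.single 0 c"

definition pvar :: "'d \<Rightarrow> 'd mpoly" where
  "pvar i = Poly_Mapping.single (Poly_Mapping.single i 1) 1"

definition peval :: "'d::finite mpoly \<Rightarrow> complex ^ 'd \<Rightarrow> complex" where
  "peval p \<xi> = (\<Sum>m\<in>Poly_Mapping.keys p.
     Poly_Mapping.lookup p m * (\<Prod>i\<in>UNIV. vec_nth \<xi> i ^ Poly_Mapping.lookup m i))"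

definition real_coeffs :: "'d mpoly \<Rightarrow> bool" where
  "real_coeffs p \<longleftrightarrow> (\<forall>m. Poly_Mapping.lookup p m \<in> \<real>)"

text \<open>In the next definition, the exponent difference is truncated only where the coefficient
  vanishes.\<close>

definition partial :: "'d \<Rightarrow> 'd mpoly \<Rightarrow> 'd mpoly" where
  "partial i p = (\<Sum>m\<in>Poly_Mapping.keys p.
     Poly_Mapping.single (m - Poly_Mapping.single i 1)
       (of_nat (Poly_Mapping.lookup m i) * Poly_Mapping.lookup p m))"

lemma lookup_partial:
  "Poly_Mapping.lookup (partial i p) m =
     of_nat (Suc (Poly_Mapping.lookup m i)) *
     Poly_Mapping.lookup p (m + Poly_Mapping.single i 1)"
proof -
  let ?e = "Poly_Mapping.single i (1::nat)"
  have "Poly_Mapping.lookup (partial i p) m =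
    (\<Sum>k\<in>Poly_Mapping.keys p. if k = m + ?e
      then of_nat (Poly_Mapping.lookup k i) * Poly_Mapping.lookup p k else 0)"
    unfolding partial_def lookup_sum
  proof (rule sum.cong)
    fix k assume "k \<in> Poly_Mapping.keys p"
    show "Poly_Mapping.lookup (Poly_Mapping.single (k - ?e)
          (of_nat (Poly_Mapping.lookup k i) * Poly_Mapping.lookup p k)) m =
        (if k = m + ?e then of_nat (Poly_Mapping.lookup k i) * Poly_Mapping.lookup p k else 0)"
    proof (cases "k - ?e = m \<and> Poly_Mapping.lookup k i \<noteq> 0")
      case True
      have "k = k - ?e + ?e"
        by (rule poly_mapping_eqI)
          (use True in \<open>auto simp: lookup_add lookup_minus lookup_single when_def\<close>)
      with True have "k = m + ?e" by simp
      then show ?thesis by simp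
    next
      case False
      then show ?thesis by (auto simp: lookup_single)
    qed
  qed simp
  then show ?thesis
    by (simp add: lookup_add in_keys_iff)
qed

lemma partial_commute: "partial i (partial j p) = partial j (partial i p)"
proof (cases "i = j")
  case False
  show ?thesis
  proof (rule poly_mapping_eqI)
    fix m
    have "m + Poly_Mapping.single i 1 + Poly_Mapping.single j 1 =
        m + Poly_Mapping.single j 1 + Poly_Mapping.single i (1::nat)"
      by (simp only: add_ac)
    with False show "Poly_Mapping.lookup (partial i (partial j p)) m =
        Poly_Mapping.lookup (partial j (partial i p)) m"
      by (simp add: lookup_partial lookup_add lookup_single)
  qed
qed simp

text \<open>The product of the derivations \<open>partial (I e)\<close> over \<open>e \<in> E\<close>; these commute.\<close>

definition partials :: "('e \<Rightarrow> 'd) \<Rightarrow> 'e set \<Rightarrow> 'd mpoly \<Rightarrow> 'd mpoly" where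
  "partials I E p = Finite_Set.fold (\<lambda>e. partial (I e)) p E"

lemma partials_empty [simp]: "partials I {} p = p"
  by (simp add: partials_def)

lemma partials_insert:
  assumes "finite E" "e \<notin> E"
  shows "partials I (insert e E) p = partial (I e) (partials I E p)"
proof -
  interpret comp_fun_commute_on UNIV "\<lambda>e. partial (I e)"
    by standard (simp add: fun_eq_iff partial_commute)
  show ?thesis
    using assms by (simp add: partials_def)
qed

section \<open>Poisson brackets\<close>

text \<open>
  A Poisson bracket on \<open>\<real>\<^sup>d\<close> with real polynomial coefficients is determined by its values on
  coordinate functions; the following is its complex bilinear extension to \<open>A\<close>.
\<close>

definition poisson_bracket :: "('d mpoly \<Rightarrow> 'd mpoly \<Rightarrow> 'd mpoly) \<Rightarrow> bool" where
  "poisson_bracket br \<longleftrightarrow>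
     (\<forall>f g h. br (f + g) h = br f h + br g h) \<and>
     (\<forall>c f g. br (pconst c * f) g = pconst c * br f g) \<and>
     (\<forall>f g. br f g = - br g f) \<and>
     (\<forall>f g h. br f (g * h) = br f g * h + g * br f h) \<and>
     (\<forall>f g h. br f (br g h) + br g (br h f) + br h (br f g) = 0)"

definition real_poisson_bracket :: "('d mpoly \<Rightarrow> 'd mpoly \<Rightarrow> 'd mpoly) \<Rightarrow> bool" where
  "real_poisson_bracket br \<longleftrightarrow>
     poisson_bracket br \<and> (\<forall>i j. real_coeffs (br (pvar i) (pvar j)))"

definition half_tensor :: "('d mpoly \<Rightarrow> 'd mpoly \<Rightarrow> 'd mpoly) \<Rightarrow> 'd \<Rightarrow> 'd \<Rightarrow> 'd mpoly" where
  "half_tensor br i j = pconst (1/2) * br (pvar i) (pvar j)"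

section \<open>Kontsevich graphs and their weights\<close>

text \<open>
  Both families of graphs have inner vertices \<open>1, \<dots>, n\<close> and a fixed set of ground vertices without
  outgoing edges: \<open>L\<close> and \<open>R\<close> for \<open>G\<^sub>n\<close> (type \<open>side\<close>), and the vertex \<open>0\<close> for \<open>G'\<^sub>n\<close> (type \<open>unit\<close>).
  The edge \<open>(k, j)\<close> is the \<open>j\<close>-th outgoing edge of the inner vertex \<open>k\<close>, and a graph is given by
  the map sending each edge to its end point.
\<close>

datatype 'g vertex = Inner nat | Ground 'g

datatype side = LSide | RSide

lemma UNIV_side: "UNIV = {LSide, RSide}"
  using side.exhaust by auto

instance side :: finite
  by standard (simp add: UNIV_side)

definition edges :: "nat \<Rightarrow> (nat \<times> nat) set" where
  "edges n = {1..n} \<times> {1, 2}"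

definition graphs :: "nat \<Rightarrow> (nat \<times> nat \<Rightarrow> 'g vertex) set" where
  "graphs n = {\<Gamma> \<in> edges n \<rightarrow>\<^sub>E Inner ` {1..n} \<union> range Ground.
     \<forall>k\<in>{1..n}. \<Gamma> (k, 1) \<noteq> \<Gamma> (k, 2) \<and> \<Gamma> (k, 1) \<noteq> Inner k \<and> \<Gamma> (k, 2) \<noteq> Inner k}"

definition into :: "nat \<Rightarrow> (nat \<times> nat \<Rightarrow> 'g vertex) \<Rightarrow> 'g vertex \<Rightarrow> (nat \<times> nat) set" where
  "into n \<Gamma> v = {e \<in> edges n. \<Gamma> e = v}"

text \<open>The multidifferential operator of a graph, with the function \<open>F v\<close> at the ground vertex
  \<open>v\<close>.\<close>

definition graph_op ::
  "('d::finite \<Rightarrow> 'd \<Rightarrow> 'd mpoly) \<Rightarrow> nat \<Rightarrow> (nat \<times> nat \<Rightarrow> 'g::finite vertex) \<Rightarrow>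
   ('g \<Rightarrow> 'd mpoly) \<Rightarrow> 'd mpoly" where
  "graph_op \<alpha> n \<Gamma> F = (\<Sum>I \<in> edges n \<rightarrow>\<^sub>E UNIV.
     (\<Prod>k=1..n. partials I (into n \<Gamma> (Inner k)) (\<alpha> (I (k, 1)) (I (k, 2)))) *
     (\<Prod>v\<in>UNIV. partials I (into n \<Gamma> (Ground v)) (F v)))"

text \<open>\<open>angle p q\<close> is a representative of the angle \<open>\<phi>(p,q)\<close>, which is defined modulo \<open>2 * pi\<close>.\<close>

definition angle :: "complex \<Rightarrow> complex \<Rightarrow> real" where
  "angle p q = Arg ((q - p) / (q - cnj p))"

text \<open>The derivative at \<open>t\<close> of a function with values in \<open>\<real>/2\<pi>\<int>\<close>: the derivative of any lift that is
  differentiable at \<open>t\<close>.\<close>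

definition deriv_mod_2pi :: "(real \<Rightarrow> real) \<Rightarrow> real \<Rightarrow> real" where
  "deriv_mod_2pi \<theta> t = (THE D. \<exists>\<psi>. (\<forall>s. (\<psi> s - \<theta> s) / (2 * pi) \<in> \<int>) \<and>
     (\<psi> has_real_derivative D) (at t))"

lemma deriv_mod_2pi_eqI:
  assumes "\<And>s. (\<psi> s - \<theta> s) / (2 * pi) \<in> \<int>" and "(\<psi> has_real_derivative D) (at t)"
  shows "deriv_mod_2pi \<theta> t = D"
  unfolding deriv_mod_2pi_def
proof (rule the_equality)
  show "\<exists>\<psi>. (\<forall>s. (\<psi> s - \<theta> s) / (2 * pi) \<in> \<int>) \<and> (\<psi> has_real_derivative D) (at t)"
    using assms by blast
next
  fix D'
  assume "\<exists>\<psi>. (\<forall>s. (\<psi> s - \<theta> s) / (2 * pi) \<in> \<int>) \<and> (\<psi> has_real_derivative D') (at t)"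
  then obtain \<psi>' where lift: "\<And>s. (\<psi>' s - \<theta> s) / (2 * pi) \<in> \<int>"
    and D': "(\<psi>' has_real_derivative D') (at t)" by blast
  define h where "h s = (\<psi>' s - \<psi> s) / (2 * pi)" for s
  have h_Ints: "h s \<in> \<int>" for s
  proof -
    have "h s = (\<psi>' s - \<theta> s) / (2 * pi) - (\<psi> s - \<theta> s) / (2 * pi)"
      by (simp add: h_def diff_divide_distrib)
    then show ?thesis using lift assms(1) by simp
  qed
  have h': "(h has_real_derivative (D' - D) / (2 * pi)) (at t)"
    unfolding h_def by (rule derivative_eq_intros D' assms(2) refl | simp add: field_simps)+
  then have "isCont h t" by (rule DERIV_isCont)
  then have "(h \<longlongrightarrow> h t) (at t)" by (simp add: isCont_def)
  then have "\<forall>\<^sub>F s in at t. dist (h s) (h t) < 1" by (rule tendstoD) simp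
  then have "\<forall>\<^sub>F s in at t. h s = h t"
  proof (rule eventually_mono)
    fix s assume "dist (h s) (h t) < 1"
    moreover obtain a b where "h s = of_int a" "h t = of_int b"
      using h_Ints by (meson Ints_cases)
    ultimately show "h s = h t" by (simp add: dist_real_def flip: of_int_diff of_int_abs)
  qed
  then have "\<forall>\<^sub>F s in nhds t. h s = h t" by (simp add: eventually_nhds_conv_at)
  then have "((\<lambda>_. h t) has_real_derivative (D' - D) / (2 * pi)) (at t)"
    by (rule iffD1[OF DERIV_cong_ev[OF refl _ refl] h'])
  then have "(D' - D) / (2 * pi) = 0" by (rule DERIV_unique) simp
  then show "D' = D" by simp
qed

fun place :: "('g \<Rightarrow> complex) \<Rightarrow> (nat \<Rightarrow> complex) \<Rightarrow> 'g vertex \<Rightarrow> complex" where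
  "place pos p (Inner k) = p k"
| "place pos p (Ground v) = pos v"

fun edge_angle ::
  "('g \<Rightarrow> complex) \<Rightarrow> (nat \<times> nat \<Rightarrow> 'g vertex) \<Rightarrow> nat \<times> nat \<Rightarrow> (nat \<Rightarrow> complex) \<Rightarrow> real" where
  "edge_angle pos \<Gamma> (k, j) p = angle (p k) (place pos p (\<Gamma> (k, j)))"

text \<open>
  The real coordinates on the space of \<open>n\<close>-tuples of complex numbers are also indexed by \<open>edges n\<close>:
  \<open>(l, 1)\<close> stands for \<open>Re p\<^sub>l\<close> and \<open>(l, 2)\<close> for \<open>Im p\<^sub>l\<close>, so that the coefficients of the one-forms
  \<open>d\<phi>\<^sub>e\<close> form a square matrix. The orders of the rows in the wedge product and of the columns in the
  standard orientation correspond under this indexing.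
\<close>

definition coord_dir :: "nat \<Rightarrow> complex" where
  "coord_dir c = (if c = 1 then 1 else \<i>)"

fun dangle ::
  "('g \<Rightarrow> complex) \<Rightarrow> (nat \<times> nat \<Rightarrow> 'g vertex) \<Rightarrow> (nat \<Rightarrow> complex) \<Rightarrow>
   nat \<times> nat \<Rightarrow> nat \<times> nat \<Rightarrow> real" where
  "dangle pos \<Gamma> p e (l, c) =
     deriv_mod_2pi (\<lambda>t. edge_angle pos \<Gamma> e (p(l := p l + of_real t * coord_dir c))) 0"

text \<open>The coefficient of the form
  \<open>d\<phi>\<^bsub>(1,1)\<^esub> \<and> d\<phi>\<^bsub>(1,2)\<^esub> \<and> \<dots> \<and> d\<phi>\<^bsub>(n,1)\<^esub> \<and> d\<phi>\<^bsub>(n,2)\<^esub>\<close> with respect to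
  \<open>dx\<^sub>1 \<and> dy\<^sub>1 \<and> \<dots> \<and> dx\<^sub>n \<and> dy\<^sub>n\<close>, i.e. a determinant. (The library's \<open>det\<close> has its dimension fixed
  by a type.)\<close>

definition wedge_coeff ::
  "('g \<Rightarrow> complex) \<Rightarrow> nat \<Rightarrow> (nat \<times> nat \<Rightarrow> 'g vertex) \<Rightarrow> (nat \<Rightarrow> complex) \<Rightarrow> real" where
  "wedge_coeff pos n \<Gamma> p = (\<Sum>\<sigma> | \<sigma> permutes edges n.
     of_int (sign \<sigma>) * (\<Prod>e\<in>edges n. dangle pos \<Gamma> p e (\<sigma> e)))"

text \<open>Removing the positions of the ground vertices only matters if these are not real.\<close>

definition configs :: "('g \<Rightarrow> complex) \<Rightarrow> nat \<Rightarrow> (nat \<Rightarrow> complex) set" where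
  "configs pos n = {p \<in> {1..n} \<rightarrow>\<^sub>E {z. 0 < Im z} - range pos. inj_on p {1..n}}"

definition weight :: "('g \<Rightarrow> complex) \<Rightarrow> nat \<Rightarrow> (nat \<times> nat \<Rightarrow> 'g vertex) \<Rightarrow> real" where
  "weight pos n \<Gamma> = 1 / (fact n * (2 * pi) ^ (2 * n)) *
     (LINT p : configs pos n | Pi\<^sub>M {1..n} (\<lambda>_. lborel). wedge_coeff pos n \<Gamma> p)"

fun pos_LR :: "side \<Rightarrow> complex" where
  "pos_LR LSide = 0"
| "pos_LR RSide = 1"

definition pos_0 :: "unit \<Rightarrow> complex" where
  "pos_0 v = \<i>"

section \<open>The star products on formal power series with polynomial coefficients\<close>

text \<open>The power series variable is \<open>\<nu>\<close>. The extensions from \<open>A\<close> to \<open>A[[\<nu>]]\<close> are the ones compatible with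
  infinite sums, i.e. the usual convolution of power series.\<close>

definition kontsevich_coeff ::
  "('d::finite \<Rightarrow> 'd \<Rightarrow> 'd mpoly) \<Rightarrow> nat \<Rightarrow> 'd mpoly \<Rightarrow> 'd mpoly \<Rightarrow> 'd mpoly" where
  "kontsevich_coeff \<alpha> n f g = (\<Sum>\<Gamma>\<in>graphs n.
     pconst (of_real (weight pos_LR n \<Gamma>)) * graph_op \<alpha> n \<Gamma> (case_side f g))"

definition kontsevich_star ::
  "('d::finite \<Rightarrow> 'd \<Rightarrow> 'd mpoly) \<Rightarrow> 'd mpoly fps \<Rightarrow> 'd mpoly fps \<Rightarrow> 'd mpoly fps" where
  "kontsevich_star \<alpha> f g = Abs_fps (\<lambda>N. \<Sum>i\<le>N. \<Sum>j\<le>N - i.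
     kontsevich_coeff \<alpha> (N - i - j) (fps_nth f i) (fps_nth g j))"

definition tangent_coeff ::
  "('d::finite \<Rightarrow> 'd \<Rightarrow> 'd mpoly) \<Rightarrow> nat \<Rightarrow> 'd mpoly \<Rightarrow> 'd mpoly" where
  "tangent_coeff \<alpha> n f = (\<Sum>\<Gamma>\<in>graphs n.
     pconst (of_real (weight pos_0 n \<Gamma>)) * graph_op \<alpha> n \<Gamma> (\<lambda>_. f))"

definition tangent_map ::
  "('d::finite \<Rightarrow> 'd \<Rightarrow> 'd mpoly) \<Rightarrow> 'd mpoly fps \<Rightarrow> 'd mpoly fps" where
  "tangent_map \<alpha> f = Abs_fps (\<lambda>N. \<Sum>i\<le>N. tangent_coeff \<alpha> (N - i) (fps_nth f i))"

text \<open>With \<open>D = inv (tangent_map \<alpha>)\<close>, this is \<open>D (D\<^sup>-\<^sup>1 f # D\<^sup>-\<^sup>1 g)\<close>.\<close>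

definition duflo_kontsevich_star ::
  "('d::finite \<Rightarrow> 'd \<Rightarrow> 'd mpoly) \<Rightarrow> 'd mpoly fps \<Rightarrow> 'd mpoly fps \<Rightarrow> 'd mpoly fps" where
  "duflo_kontsevich_star \<alpha> f g =
     inv (tangent_map \<alpha>) (kontsevich_star \<alpha> (tangent_map \<alpha> f) (tangent_map \<alpha> g))"

section \<open>The involution\<close>

definition poly_conj :: "'d::finite mpoly \<Rightarrow> 'd mpoly" where
  "poly_conj f = (THE g. \<forall>\<xi>. peval g \<xi> = cnj (peval f (\<chi> i. cnj (vec_nth \<xi> i))))"

lemma digits_unique:
  fixes a b :: "nat \<Rightarrow> nat"
  assumes "\<And>i. i < d \<Longrightarrow> a i < N" "\<And>i. i < d \<Longrightarrow> b i < N"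
    and "(\<Sum>i<d. a i * N ^ i) = (\<Sum>i<d. b i * N ^ i)" and "i < d"
  shows "a i = b i"
  using assms
proof (induction d arbitrary: a b i)
  case (Suc d)
  have shift: "(\<Sum>i<Suc d. c i * N ^ i) = c 0 + N * (\<Sum>i<d. c (Suc i) * N ^ i)" for c :: "nat \<Rightarrow> nat"
    unfolding sum.lessThan_Suc_shift sum_distrib_left by (simp add: mult.left_commute)
  have eq: "a 0 + N * (\<Sum>i<d. a (Suc i) * N ^ i) = b 0 + N * (\<Sum>i<d. b (Suc i) * N ^ i)"
    using Suc.prems(3) unfolding shift .
  have lt: "a 0 < N" "b 0 < N" using Suc.prems(1,2) by auto
  from arg_cong[OF eq, of "\<lambda>x. x mod N"] lt have 0: "a 0 = b 0" by simp
  with eq lt have "(\<Sum>i<d. a (Suc i) * N ^ i) = (\<Sum>i<d. b (Suc i) * N ^ i)" by simp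
  then have "a (Suc j) = b (Suc j)" if "j < d" for j
    using Suc.IH[of "\<lambda>i. a (Suc i)" "\<lambda>i. b (Suc i)" j] Suc.prems(1,2) that by simp
  with 0 Suc.prems(4) show ?case by (cases i) auto
qed simp

lemma peval_superset:
  assumes "finite S" "Poly_Mapping.keys p \<subseteq> S"
  shows "peval p \<xi> = (\<Sum>m\<in>S.
     Poly_Mapping.lookup p m * (\<Prod>i\<in>UNIV. vec_nth \<xi> i ^ Poly_Mapping.lookup m i))"
  unfolding peval_def by (rule sum.mono_neutral_left) (use assms in \<open>auto simp: in_keys_iff\<close>)

lemma peval_inject:
  fixes p q :: "'d::finite mpoly"
  assumes "\<And>\<xi>. peval p \<xi> = peval q \<xi>"
  shows "p = q"
proof (rule poly_mapping_eqI)
  fix m0 :: "'d \<Rightarrow>\<^sub>0 nat"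
  define S where "S = insert m0 (Poly_Mapping.keys p \<union> Poly_Mapping.keys q)"
  have S: "finite S" "m0 \<in> S" "Poly_Mapping.keys p \<subseteq> S" "Poly_Mapping.keys q \<subseteq> S"
    by (auto simp: S_def)
  define N where "N = Suc (\<Sum>m\<in>S. \<Sum>i\<in>UNIV. Poly_Mapping.lookup m i)"
  have N: "Poly_Mapping.lookup m i < N" if "m \<in> S" for m i
  proof -
    have "Poly_Mapping.lookup m i \<le> (\<Sum>i\<in>UNIV. Poly_Mapping.lookup m i)"
      by (rule member_le_sum) auto
    also have "\<dots> \<le> (\<Sum>m\<in>S. \<Sum>i\<in>UNIV. Poly_Mapping.lookup m i)"
      using that S(1) by (intro member_le_sum[of m S "\<lambda>m. \<Sum>i\<in>UNIV. Poly_Mapping.lookup m i"]) auto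
    finally show ?thesis by (simp add: N_def)
  qed
  obtain h where h: "bij_betw h {0..<CARD('d)} (UNIV :: 'd set)"
    using ex_bij_betw_nat_finite[of "UNIV :: 'd set"] by auto
  define e where "e = inv_into {0..<CARD('d)} h"
  have he: "h (e i) = i" "e i < CARD('d)" for i
    using bij_betw_inv_into_right[OF h, of i] bij_betwE[OF bij_betw_inv_into[OF h]]
    by (auto simp: e_def)
  have eh: "e (h k) = k" if "k < CARD('d)" for k
    using bij_betw_inv_into_left[OF h] that by (auto simp: e_def)
  define w where "w m = (\<Sum>i\<in>UNIV. Poly_Mapping.lookup m i * N ^ e i)" for m
  have w: "w m = (\<Sum>k<CARD('d). Poly_Mapping.lookup m (h k) * N ^ k)" for m
  proof -
    have "w m = (\<Sum>k\<in>{0..<CARD('d)}. Poly_Mapping.lookup m (h k) * N ^ e (h k))"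
      unfolding w_def by (rule sum.reindex_bij_betw[OF h, symmetric])
    also have "\<dots> = (\<Sum>k<CARD('d). Poly_Mapping.lookup m (h k) * N ^ k)"
      by (rule sum.cong) (auto simp: eh)
    finally show ?thesis .
  qed
  have inj: "inj_on w S"
  proof (rule inj_onI, rule poly_mapping_eqI)
    fix m m' i assume m: "m \<in> S" "m' \<in> S" "w m = w m'"
    have "Poly_Mapping.lookup m (h (e i)) = Poly_Mapping.lookup m' (h (e i))"
      using digits_unique[of "CARD('d)" "\<lambda>k. Poly_Mapping.lookup m (h k)" N
          "\<lambda>k. Poly_Mapping.lookup m' (h k)" "e i"] m(3) N[OF m(1)] N[OF m(2)] he(2)
      unfolding w by blast
    then show "Poly_Mapping.lookup m i = Poly_Mapping.lookup m' i" by (simp add: he)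
  qed
  define P where "P = (\<Sum>m\<in>S. monom (Poly_Mapping.lookup p m - Poly_Mapping.lookup q m) (w m))"
  have "poly P z = 0" for z
  proof -
    define \<xi> :: "complex ^ 'd" where "\<xi> = (\<chi> i. z ^ (N ^ e i))"
    have mon: "(\<Prod>i\<in>UNIV. vec_nth \<xi> i ^ Poly_Mapping.lookup m i) = z ^ w m" for m
      unfolding \<xi>_def w_def power_sum
      by (intro prod.cong refl) (simp, metis mult.commute power_mult)
    have "poly P z = peval p \<xi> - peval q \<xi>"
      unfolding P_def peval_superset[OF S(1,3)] peval_superset[OF S(1,4)] mon
      by (simp add: poly_sum poly_monom algebra_simps sum_subtractf)
    then show ?thesis using assms by simp
  qed
  then have "P = 0" using poly_all_0_iff_0 by blast
  then have "0 = coeff P (w m0)" by simp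
  also have "\<dots> = (\<Sum>m\<in>S. if m = m0
      then Poly_Mapping.lookup p m - Poly_Mapping.lookup q m else 0)"
    unfolding P_def coeff_sum by (rule sum.cong) (use inj S(2) in \<open>auto dest: inj_onD\<close>)
  also have "\<dots> = Poly_Mapping.lookup p m0 - Poly_Mapping.lookup q m0"
    using S(1,2) by (simp add: sum.delta)
  finally show "Poly_Mapping.lookup p m0 = Poly_Mapping.lookup q m0" by simp
qed

lemma poly_conj_eq: "poly_conj f = Poly_Mapping.map cnj f"
  and peval_poly_conj: "peval (poly_conj f) \<xi> = cnj (peval f (\<chi> i. cnj (vec_nth \<xi> i)))"
proof -
  have lookup: "Poly_Mapping.lookup (Poly_Mapping.map cnj f) m = cnj (Poly_Mapping.lookup f m)" for m
    by (simp add: Poly_Mapping.map.rep_eq when_def)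
  then have keys: "Poly_Mapping.keys (Poly_Mapping.map cnj f) = Poly_Mapping.keys f"
    by (auto simp: in_keys_iff)
  have eval: "peval (Poly_Mapping.map cnj f) \<xi> = cnj (peval f (\<chi> i. cnj (vec_nth \<xi> i)))" for \<xi>
    by (simp add: peval_def keys lookup)
  show eq: "poly_conj f = Poly_Mapping.map cnj f"
    unfolding poly_conj_def by (rule the_equality) (auto simp: eval intro: peval_inject)
  show "peval (poly_conj f) \<xi> = cnj (peval f (\<chi> i. cnj (vec_nth \<xi> i)))"
    unfolding eq by (rule eval)
qed

definition series_conj :: "'d::finite mpoly fps \<Rightarrow> 'd mpoly fps" where
  "series_conj f = Abs_fps (\<lambda>k. (- 1) ^ k * poly_conj (fps_nth f k))"

definition scalar_conj :: "complex fps \<Rightarrow> complex fps" where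
  "scalar_conj c = Abs_fps (\<lambda>k. (- 1) ^ k * cnj (fps_nth c k))"

definition scalar_series :: "complex fps \<Rightarrow> 'd mpoly fps" where
  "scalar_series c = Abs_fps (\<lambda>k. pconst (fps_nth c k))"

text \<open>\<open>A\<close> as a subset of \<open>A[[\<nu>]]\<close>.\<close>

definition const_series :: "'d mpoly fps set" where
  "const_series = range fps_const"

end

theory Submission
  imports Defs
begin

text \<open>
  The reflection \<open>z \<mapsto> c - cnj z\<close> of the upper half-plane negates all angles modulo \<open>2\<pi>\<close>. The \<open>2n\<close> signs
  of the one-forms cancel, and the reflection of \<open>n\<close> points changes the orientation by \<open>(-1)\<^sup>n\<close>. For
  \<open>c = 1\<close> it exchanges \<open>L\<close> and \<open>R\<close>, so exchanging the arguments of the coefficient of \<open>\<nu>\<^sup>n\<close> in the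
  Kontsevich product multiplies it by \<open>(-1)\<^sup>n\<close>; for \<open>c = 0\<close> it fixes \<open>\<i>\<close>, so the odd coefficients of the
  tangent map vanish. As the weights and the Poisson tensor are real and conjugation maps \<open>\<nu>\<close> to
  \<open>-\<nu>\<close>, conjugation reverses the Kontsevich product and commutes with the tangent map, which is
  bijective because its constant term is the identity.
\<close>

section \<open>Behaviour of the weights under a reflection\<close>

text \<open>\<open>deriv_mod_2pi\<close> is a definite description, so computing with it requires a
  lift known to be differentiable. For real s, \<open>cnj (p + s * a) = cnj p + s * cnj a\<close>;
  hence the quotient inside \<open>Arg\<close> extends to a rational function of a complex variable,
  and its logarithm provides the lift.\<close>

lemma angle_line_lift:
  fixes p q a b :: complex
  assumes "p \<noteq> q" "q \<noteq> cnj p"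
  obtains \<psi> D where
    "\<And>s. (\<psi> s - angle (p + of_real s * a) (q + of_real s * b)) / (2 * pi) \<in> \<int>"
    "(\<psi> has_real_derivative D) (at 0)"
proof -
  define U where "U z = ((q - p) + z * (b - a)) / ((q - cnj p) + z * (b - cnj a))" for z
  define u where "u s = U (of_real s)" for s :: real
  have angle_u: "angle (p + of_real s * a) (q + of_real s * b) = Arg (u s)" for s
    by (simp add: angle_def u_def U_def algebra_simps)
  have U0: "U 0 \<noteq> 0" using assms by (simp add: U_def)
  have "\<exists>D. (U has_field_derivative D) (at 0)"
    unfolding U_def field_differentiable_def[symmetric] using assms
    by (intro field_differentiable_divide field_differentiable_add field_differentiable_mult
        field_differentiable_const field_differentiable_ident) simp
  then obtain D where U': "(U has_field_derivative D) (at 0)" by blast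
  \<comment> \<open>Dividing by \<open>U 0\<close> moves the value at 0 to 1, away from the branch
    cut of \<open>Ln\<close>; \<open>Arg (U 0)\<close> is added back afterwards.\<close>
  then have "((\<lambda>z. Ln (U z / U 0)) has_field_derivative inverse (U 0 / U 0) * (D / U 0)) (at 0)"
    by (intro DERIV_chain2[OF has_field_derivative_Ln] DERIV_cdivide) (use U0 in auto)
  then have "((\<lambda>s. Ln (u s / U 0)) has_vector_derivative D / U 0) (at 0)"
    unfolding u_def using U0 has_vector_derivative_real_field[of "\<lambda>z. Ln (U z / U 0)" _ 0 UNIV]
    by simp
  then have "((\<lambda>s. Im (Ln (u s / U 0)) + Arg (U 0)) has_vector_derivative Im (D / U 0) + 0) (at 0)"
    by (intro has_vector_derivative_add has_vector_derivative_const
        bounded_linear.has_vector_derivative[OF bounded_linear_Im])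
  then have Im_Ln: "((\<lambda>s. Im (Ln (u s / U 0)) + Arg (U 0)) has_real_derivative Im (D / U 0)) (at 0)"
    by (simp add: has_real_derivative_iff_has_vector_derivative)
  \<comment> \<open>The congruence must hold for every s. Where the quotient is 0, possibly through
    division by 0, \<open>Arg\<close> is 0 by convention, which forces this value of \<psi>; near s
    = 0 the case does not occur.\<close>
  define \<psi> where "\<psi> s = (if u s = 0 then 0 else Im (Ln (u s / U 0)) + Arg (U 0))" for s
  have "isCont (\<lambda>s. U (of_real s)) (0::real)"
    by (rule isCont_o2[where g = U]) (use DERIV_isCont[OF U'] in simp_all)
  then have "isCont u 0" by (simp only: u_def[abs_def])
  moreover have "u 0 \<noteq> 0" using U0 by (simp add: u_def)
  ultimately have "\<forall>\<^sub>F s in nhds 0. u s \<noteq> 0"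
    by (auto simp: isCont_def eventually_nhds_conv_at dest: tendsto_imp_eventually_ne)
  then have "\<forall>\<^sub>F s in nhds 0. \<psi> s = Im (Ln (u s / U 0)) + Arg (U 0)"
    by (rule eventually_mono) (simp add: \<psi>_def)
  then have "(\<psi> has_real_derivative Im (D / U 0)) (at 0)"
    by (rule iffD2[OF DERIV_cong_ev[OF refl _ refl] Im_Ln])
  moreover have "(\<psi> s - Arg (u s)) / (2 * pi) \<in> \<int>" for s
  proof (cases "u s = 0")
    case False
    define x where "x = Arg (u s / U 0) + Arg (U 0)"
    have "Arg (u s) = x + (if x \<in> {-pi<..pi} then 0 else if x > pi then -2*pi else 2*pi)"
      using Arg_times'[of "u s / U 0" "U 0"] False U0 by (simp add: x_def)
    moreover have "\<psi> s = x" using False U0 by (simp add: \<psi>_def x_def Arg_eq_Im_Ln)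
    ultimately show ?thesis by simp
  qed (simp add: \<psi>_def Arg_zero)
  ultimately show thesis using that unfolding angle_u by blast
qed

text \<open>The chain rule is applied to the lift \<open>- \<psi> (r * s)\<close> of \<theta>': the
  minus sign comes from the negated angle, r from the changed speed.\<close>

lemma deriv_mod_2pi_reflect:
  assumes lift: "\<And>s. (\<psi> s - \<theta> s) / (2 * pi) \<in> \<int>" "(\<psi> has_real_derivative D) (at 0)"
    and refl: "\<And>s. (\<theta>' s + \<theta> (r * s)) / (2 * pi) \<in> \<int>"
  shows "deriv_mod_2pi \<theta>' 0 = - r * deriv_mod_2pi \<theta> 0"
proof -
  have "((\<lambda>s. - \<psi> (r * s)) has_real_derivative - (D * r)) (at 0)"
  proof (rule DERIV_minus, rule DERIV_chain2[of \<psi> D])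
    show "((*) r has_real_derivative r) (at 0)" by (rule DERIV_cmult_Id)
  qed (use lift(2) in simp)
  moreover have "(- \<psi> (r * s) - \<theta>' s) / (2 * pi) \<in> \<int>" for s
  proof -
    have "(- \<psi> (r * s) - \<theta>' s) / (2 * pi) =
        - ((\<psi> (r * s) - \<theta> (r * s)) / (2 * pi)) - (\<theta>' s + \<theta> (r * s)) / (2 * pi)"
      by (simp add: field_simps)
    then show ?thesis using lift(1)[of "r * s"] refl[of s] by (simp only: Ints_diff Ints_minus)
  qed
  ultimately show ?thesis
    using deriv_mod_2pi_eqI[of "\<lambda>s. - \<psi> (r * s)"] deriv_mod_2pi_eqI[OF lift] by simp
qed

section \<open>The reflection: its effect on angles and on Lebesgue measure\<close>

definition reflect :: "real \<Rightarrow> complex \<Rightarrow> complex" where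
  "reflect c z = of_real c - cnj z"

lemma reflect_reflect [simp]: "reflect c (reflect c z) = z"
  by (simp add: reflect_def)

lemma Im_reflect [simp]: "Im (reflect c z) = Im z"
  by (simp add: reflect_def)

lemma reflect_eq_iff [simp]: "reflect c z = reflect c w \<longleftrightarrow> z = w"
  by (simp add: reflect_def)

text \<open>The quotient inside \<open>Arg\<close> is conjugated. Equality holds only modulo 2 pi:
  for a negative real quotient both arguments are pi.\<close>

lemma angle_reflect: "(angle (reflect c p) (reflect c q) + angle p q) / (2 * pi) \<in> \<int>"
proof -
  have "(reflect c q - reflect c p) / (reflect c q - cnj (reflect c p)) = cnj ((q - p) / (q - cnj p))"
  proof -
    have "reflect c q - reflect c p = - cnj (q - p)"
      "reflect c q - cnj (reflect c p) = - cnj (q - cnj p)"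
      by (simp_all add: reflect_def)
    then show ?thesis by (simp only: complex_cnj_divide minus_divide_left[symmetric] minus_divide_right[symmetric] minus_minus)
  qed
  then have angle: "angle (reflect c p) (reflect c q) = Arg (cnj ((q - p) / (q - cnj p)))"
    by (simp only: angle_def)
  have "(Arg (cnj z) + Arg z) / (2 * pi) \<in> \<int>" for z
    by (cases "z \<in> \<real>") (auto simp: Arg_cnj elim!: Reals_cases)
  then show ?thesis unfolding angle by (simp only: angle_def)
qed

text \<open>In the basis 1, \<open>\<i>\<close> the reflection is a translation after the diagonal
  map with entries -1 and 1, whose determinant has absolute value 1.\<close>

lemma distr_lborel_reflect: "distr lborel lborel (reflect c) = lborel"
proof -
  define r where "r j = (if j = 1 then - 1 else 1 :: real)" for j :: complex
  have T: "of_real c + (\<Sum>j\<in>Basis. (r j * inner z j) *\<^sub>R j) = reflect c z" for z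
    by (simp add: Basis_complex_def r_def reflect_def complex_eq_iff)
  have "lborel = density (distr lborel borel (reflect c)) (\<lambda>_. \<Prod>j\<in>Basis. \<bar>r j\<bar>)"
    using lborel_affine_euclidean[of r "of_real c"] unfolding T by (simp add: r_def)
  also have "\<dots> = distr lborel lborel (reflect c)"
    by (simp add: Basis_complex_def r_def density_1 cong: distr_cong)
  finally show ?thesis by simp
qed

definition reflect_config :: "nat \<Rightarrow> real \<Rightarrow> (nat \<Rightarrow> complex) \<Rightarrow> nat \<Rightarrow> complex" where
  "reflect_config n c p = (\<lambda>k\<in>{1..n}. reflect c (p k))"

lemma measurable_reflect: "reflect c \<in> borel \<rightarrow>\<^sub>M borel"
  unfolding reflect_def by (intro borel_measurable_continuous_onI continuous_intros)

lemma measurable_reflect_config: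
  "reflect_config n c \<in> Pi\<^sub>M {1..n} (\<lambda>_. lborel) \<rightarrow>\<^sub>M Pi\<^sub>M {1..n} (\<lambda>_. lborel)"
  unfolding reflect_config_def
  by (intro measurable_restrict measurable_compose[OF measurable_component_singleton])
    (simp_all add: measurable_reflect)

text \<open>A product measure is determined by its values on boxes, and the preimage of a box is the
  box of the preimages of its sides.\<close>

lemma distr_reflect_config:
  "distr (Pi\<^sub>M {1..n} (\<lambda>_. lborel)) (Pi\<^sub>M {1..n} (\<lambda>_. lborel)) (reflect_config n c) =
   Pi\<^sub>M {1..n} (\<lambda>_. lborel)"
proof -
  interpret product_sigma_finite "\<lambda>_::nat. lborel :: complex measure" ..
  show ?thesis
  proof (rule PiM_eqI)
    fix A :: "nat \<Rightarrow> complex set" assume A: "\<And>i. i \<in> {1..n} \<Longrightarrow> A i \<in> sets lborel"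
    have vim: "reflect_config n c -` Pi\<^sub>E {1..n} A \<inter> space (Pi\<^sub>M {1..n} (\<lambda>_. lborel)) =
        Pi\<^sub>E {1..n} (\<lambda>i. reflect c -` A i)"
      by (auto simp: reflect_config_def space_PiM PiE_iff)
    have vimA: "reflect c -` A i \<in> sets lborel" if "i \<in> {1..n}" for i
      using measurable_sets[OF measurable_reflect, of "A i"] A[OF that] by simp
    have "emeasure lborel (reflect c -` A i) = emeasure lborel (A i)" if "i \<in> {1..n}" for i
      using arg_cong[OF distr_lborel_reflect[of c], of "\<lambda>M. emeasure M (A i)"] A[OF that] measurable_reflect[of c]
      by (simp add: emeasure_distr)
    then show "emeasure (distr (Pi\<^sub>M {1..n} (\<lambda>_. lborel)) (Pi\<^sub>M {1..n} (\<lambda>_. lborel))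
        (reflect_config n c)) (Pi\<^sub>E {1..n} A) = (\<Prod>i\<in>{1..n}. emeasure lborel (A i))"
      by (subst emeasure_distr[OF measurable_reflect_config])
        (simp_all only: vim emeasure_PiM[OF finite_atLeastAtMost vimA] sets_PiM_I_finite[OF finite_atLeastAtMost A]
          cong: prod.cong)
  qed simp_all
qed

text \<open>No measurability of the integrand is needed, because \<open>T\<close> is invertible.\<close>

lemma integral_involution:
  fixes g :: "'a \<Rightarrow> 'b::{banach, second_countable_topology}"
  assumes T: "T \<in> M \<rightarrow>\<^sub>M M" "distr M M T = M" "\<And>x. x \<in> space M \<Longrightarrow> T (T x) = x"
  shows "(\<integral>x. g (T x) \<partial>M) = (\<integral>x. g x \<partial>M)"
proof (cases "g \<in> borel_measurable M")
  case True
  then show ?thesis using integral_distr[OF T(1) True] T(2) by simp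
next
  case False
  have "(\<lambda>x. g (T x)) \<notin> borel_measurable M"
  proof
    assume "(\<lambda>x. g (T x)) \<in> borel_measurable M"
    then have "(\<lambda>x. g (T (T x))) \<in> borel_measurable M" by (rule measurable_compose[OF T(1)])
    also have "?this \<longleftrightarrow> g \<in> borel_measurable M"
      by (rule measurable_cong) (simp add: T(3))
    finally show False using False by simp
  qed
  with False have "\<not> integrable M (\<lambda>x. g (T x))" "\<not> integrable M g"
    using borel_measurable_integrable by auto
  then show ?thesis by (simp add: not_integrable_integral_eq)
qed

section \<open>Graphs with permuted ground vertices\<close>

lemma finite_edges [simp]: "finite (edges n)"
  by (simp add: edges_def)

text \<open>The restriction to \<open>edges n\<close> keeps the map extensional, as membership in
  \<open>graphs n\<close> demands.\<close>

definition relabel :: "nat \<Rightarrow> ('g \<Rightarrow> 'h) \<Rightarrow> (nat \<times> nat \<Rightarrow> 'g vertex) \<Rightarrow> nat \<times> nat \<Rightarrow> 'h vertex" where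
  "relabel n \<tau> \<Gamma> = (\<lambda>e\<in>edges n. map_vertex \<tau> (\<Gamma> e))"

lemma map_vertex_eq_Inner_iff [simp]: "map_vertex \<tau> v = Inner k \<longleftrightarrow> v = Inner k"
  by (cases v) auto

lemma map_vertex_involution:
  assumes "\<And>v. \<tau> (\<tau> v) = v"
  shows "map_vertex \<tau> (map_vertex \<tau> v) = v"
  using assms by (cases v) auto

lemma relabel_involution:
  assumes "\<And>v. \<tau> (\<tau> v) = v" "\<Gamma> \<in> graphs n"
  shows "relabel n \<tau> (relabel n \<tau> \<Gamma>) = \<Gamma>"
proof
  fix e
  show "relabel n \<tau> (relabel n \<tau> \<Gamma>) e = \<Gamma> e"
  proof (cases "e \<in> edges n")
    case True
    then show ?thesis by (simp add: relabel_def map_vertex_involution[of \<tau>, OF assms(1)])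
  next
    case False
    then have "\<Gamma> e = undefined" using assms(2) by (auto simp: graphs_def intro: PiE_arb)
    with False show ?thesis by (simp add: relabel_def)
  qed
qed

lemma relabel_in_graphs:
  assumes "\<And>v. \<tau> (\<tau> v) = v" "\<Gamma> \<in> graphs n"
  shows "relabel n \<tau> \<Gamma> \<in> graphs n"
proof -
  have "map_vertex \<tau> v \<in> Inner ` {1..n} \<union> range Ground"
    if "v \<in> Inner ` {1..n} \<union> range Ground" for v :: "'a vertex"
    using that by (cases v) auto
  then have "relabel n \<tau> \<Gamma> \<in> edges n \<rightarrow>\<^sub>E Inner ` {1..n} \<union> range Ground"
    using assms(2) by (auto simp: graphs_def relabel_def simp del: Un_iff intro!: restrict_PiE_iff[THEN iffD2] dest: PiE_mem)
  moreover have "relabel n \<tau> \<Gamma> (k, 1) \<noteq> relabel n \<tau> \<Gamma> (k, 2)"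
    "relabel n \<tau> \<Gamma> (k, 1) \<noteq> Inner k" "relabel n \<tau> \<Gamma> (k, 2) \<noteq> Inner k" if k: "k \<in> {1..n}" for k
  proof -
    have relabel: "relabel n \<tau> \<Gamma> (k, 1) = map_vertex \<tau> (\<Gamma> (k, 1))"
      "relabel n \<tau> \<Gamma> (k, 2) = map_vertex \<tau> (\<Gamma> (k, 2))"
      using k by (auto simp: relabel_def edges_def)
    have \<Gamma>: "\<Gamma> (k, 1) \<noteq> \<Gamma> (k, 2)" "\<Gamma> (k, 1) \<noteq> Inner k" "\<Gamma> (k, 2) \<noteq> Inner k"
      using assms(2) k unfolding graphs_def by blast+
    show "relabel n \<tau> \<Gamma> (k, 1) \<noteq> relabel n \<tau> \<Gamma> (k, 2)"
      unfolding relabel using \<Gamma>(1) arg_cong[of _ _ "map_vertex \<tau>"]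
      by (metis map_vertex_involution[of \<tau>, OF assms(1)])
    show "relabel n \<tau> \<Gamma> (k, 1) \<noteq> Inner k" "relabel n \<tau> \<Gamma> (k, 2) \<noteq> Inner k"
      unfolding relabel using \<Gamma>(2,3) by simp_all
  qed
  ultimately show ?thesis unfolding graphs_def by blast
qed

lemma bij_betw_relabel:
  assumes "\<And>v. \<tau> (\<tau> v) = v"
  shows "bij_betw (relabel n \<tau>) (graphs n) (graphs n)"
  by (rule bij_betw_byWitness[where f' = "relabel n \<tau>"])
    (simp_all add: relabel_involution[OF assms] relabel_in_graphs[OF assms] image_subset_iff)

section \<open>Transformation of the weights\<close>

locale ground_reflection =
  fixes pos :: "'g \<Rightarrow> complex" and \<tau> :: "'g \<Rightarrow> 'g" and c :: real
  assumes pos_reflect: "pos (\<tau> v) = reflect c (pos v)"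
    and Im_pos: "0 \<le> Im (pos v)"
begin

lemma reflect_config_reflect_config:
  assumes "p \<in> extensional {1..n}"
  shows "reflect_config n c (reflect_config n c p) = p"
proof
  fix k
  show "reflect_config n c (reflect_config n c p) k = p k"
    using extensional_arb[OF assms, of k] by (cases "k \<in> {1..n}") (simp_all add: reflect_config_def)
qed

lemma reflect_config_in_configs:
  assumes "p \<in> configs pos n"
  shows "reflect_config n c p \<in> configs pos n"
proof -
  have "reflect c z \<notin> range pos" if "z \<notin> range pos" for z
  proof
    assume "reflect c z \<in> range pos"
    then obtain v where "reflect c z = pos v" by auto
    then have "pos (\<tau> v) = reflect c (reflect c z)" by (simp only: pos_reflect)
    then have "z = pos (\<tau> v)" by simp
    with that show False by (simp only: rangeI simp_thms)
  qed
  moreover have p: "0 < Im (p k)" "p k \<notin> range pos" if "k \<in> {1..n}" for k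
    using assms that by (auto simp: configs_def dest: PiE_mem)
  ultimately have "(\<lambda>k\<in>{1..n}. reflect c (p k)) \<in> {1..n} \<rightarrow>\<^sub>E {z. 0 < Im z} - range pos"
    by (intro restrict_PiE_iff[THEN iffD2] ballI DiffI CollectI) simp_all
  moreover have "inj_on (\<lambda>k\<in>{1..n}. reflect c (p k)) {1..n}"
    unfolding inj_on_restrict_eq
    by (rule inj_onI) (use assms in \<open>auto simp: configs_def dest: inj_onD\<close>)
  ultimately show ?thesis
    by (simp only: configs_def reflect_config_def mem_Collect_eq simp_thms)
qed

lemma reflect_config_in_configs_iff:
  assumes "p \<in> extensional {1..n}"
  shows "reflect_config n c p \<in> configs pos n \<longleftrightarrow> p \<in> configs pos n"
  using reflect_config_in_configs[of p n] reflect_config_in_configs[of "reflect_config n c p" n]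
  by (auto simp: reflect_config_reflect_config[OF assms])

text \<open>Moving a coordinate of the reflected configuration by s corresponds to moving the same
  coordinate of the original by \<open>r * s\<close>, with r = -1 for a real part and r = 1 for an
  imaginary part. As the angle is negated too, the factor is \<open>- r\<close>.\<close>

lemma dangle_reflect:
  assumes \<Gamma>: "\<Gamma> \<in> graphs n" and p: "p \<in> configs pos n"
    and e: "e \<in> edges n" and lc: "(l, d) \<in> edges n"
  shows "dangle pos (relabel n \<tau> \<Gamma>) (reflect_config n c p) e (l, d) =
    (if d = 1 then 1 else - 1) * dangle pos \<Gamma> p e (l, d)"
proof -
  obtain k j where kj: "e = (k, j)" by (cases e)
  have k: "k \<in> {1..n}" and l: "l \<in> {1..n}" using e lc by (auto simp: kj edges_def)
  define q where "q = place pos p (\<Gamma> e)"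
  \<comment> \<open>The velocities of the source and of the target of e when the coordinate (l, d)
    moves.\<close>
  define a where "a = (if k = l then coord_dir d else 0)"
  define b where "b = (if \<Gamma> e = Inner l then coord_dir d else 0)"
  define r :: real where "r = (if d = 1 then - 1 else 1)"
  have target: "\<Gamma> e \<in> Inner ` ({1..n} - {k}) \<union> range Ground"
  proof -
    have "\<Gamma> e \<in> Inner ` {1..n} \<union> range Ground" using \<Gamma> e by (auto simp: graphs_def)
    moreover have "\<Gamma> e \<noteq> Inner k" using \<Gamma> e by (auto simp: graphs_def kj edges_def)
    ultimately show ?thesis by auto
  qed
  have line: "edge_angle pos \<Gamma> e (p(l := p l + of_real s * coord_dir d)) =
      angle (p k + of_real s * a) (q + of_real s * b)" for s
    using target by (auto simp: kj a_def b_def q_def)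
  have Im_p: "0 < Im (p k)" using p k by (auto simp: configs_def)
  from p have p_inner: "0 < Im (p i)" "p i \<notin> range pos" if "i \<in> {1..n}" for i
    using that by (auto simp: configs_def PiE_iff)
  have inj: "inj_on p {1..n}" using p by (simp add: configs_def)
  \<comment> \<open>Without loops and with p injective, the two ends of the edge are distinct; and a
    target in the closed half-plane is never the conjugate of a point of the open one. These are the
    conditions for the lift.\<close>
  have "p k \<noteq> q \<and> 0 \<le> Im q"
  proof (cases "\<Gamma> e")
    case (Inner m)
    then have "m \<in> {1..n}" "m \<noteq> k" "q = p m" using target by (auto simp: q_def)
    then show ?thesis using p_inner(1)[of m] inj_onD[OF inj, of k m] k by auto
  next
    case (Ground v)
    then show ?thesis using p_inner(2)[OF k] Im_pos by (auto simp: q_def)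
  qed
  then have "p k \<noteq> q" "q \<noteq> cnj (p k)" using Im_p by (auto simp: complex_eq_iff)
  then obtain \<psi> D where lift:
    "\<And>s. (\<psi> s - edge_angle pos \<Gamma> e (p(l := p l + of_real s * coord_dir d))) / (2 * pi) \<in> \<int>"
    "(\<psi> has_real_derivative D) (at 0)"
    unfolding line by (rule angle_line_lift[where a = a and b = b]) blast
  have dir: "reflect c z + of_real s * coord_dir d = reflect c (z + of_real (r * s) * coord_dir d)" for s z
    by (simp add: r_def coord_dir_def reflect_def)
  have refl_line: "edge_angle pos (relabel n \<tau> \<Gamma>) e
      ((reflect_config n c p)(l := reflect_config n c p l + of_real s * coord_dir d)) =
      angle (reflect c (p k + of_real (r * s) * a)) (reflect c (q + of_real (r * s) * b))" for s
  proof -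
    let ?p = "(reflect_config n c p)(l := reflect_config n c p l + of_real s * coord_dir d)"
    have "?p i = reflect c (p i + of_real (r * s) * (if i = l then coord_dir d else 0))"
      if "i \<in> {1..n}" for i
      using that l by (simp add: reflect_config_def dir)
    then have "?p k = reflect c (p k + of_real (r * s) * a)"
      and "place pos ?p (map_vertex \<tau> (\<Gamma> e)) = reflect c (q + of_real (r * s) * b)"
      using target k by (auto simp: a_def b_def q_def pos_reflect simp del: fun_upd_apply)
    then show ?thesis using e by (simp add: kj relabel_def del: fun_upd_apply)
  qed
  have "deriv_mod_2pi (\<lambda>s. edge_angle pos (relabel n \<tau> \<Gamma>) e
      ((reflect_config n c p)(l := reflect_config n c p l + of_real s * coord_dir d))) 0 =
      - r * deriv_mod_2pi (\<lambda>s. edge_angle pos \<Gamma> e (p(l := p l + of_real s * coord_dir d))) 0"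
    by (rule deriv_mod_2pi_reflect[OF lift]) (unfold refl_line line, rule angle_reflect)
  then show ?thesis by (simp add: r_def)
qed

text \<open>Each term of the determinant uses every column exactly once, so the column signs from
  \<open>dangle_reflect\<close> form a common factor: one -1 for the imaginary part of each of the n
  points.\<close>

lemma wedge_coeff_reflect:
  assumes "\<Gamma> \<in> graphs n" "p \<in> configs pos n"
  shows "wedge_coeff pos n (relabel n \<tau> \<Gamma>) (reflect_config n c p) = (- 1) ^ n * wedge_coeff pos n \<Gamma> p"
proof -
  define \<epsilon> :: "nat \<times> nat \<Rightarrow> real" where "\<epsilon> e = (if snd e = 1 then 1 else - 1)" for e
  have prod_\<epsilon>: "(\<Prod>e\<in>edges n. \<epsilon> e) = (- 1) ^ n"
  proof -
    have "(\<Prod>e\<in>edges n. \<epsilon> e) = (\<Prod>k\<in>{1..n}. \<Prod>j\<in>{1, 2}. \<epsilon> (k, j))"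
      unfolding edges_def prod.cartesian_product by simp
    then show ?thesis by (simp add: \<epsilon>_def)
  qed
  have "(\<Prod>e\<in>edges n. dangle pos (relabel n \<tau> \<Gamma>) (reflect_config n c p) e (\<sigma> e)) =
      (- 1) ^ n * (\<Prod>e\<in>edges n. dangle pos \<Gamma> p e (\<sigma> e))" if "\<sigma> permutes edges n" for \<sigma>
  proof -
    have "(\<Prod>e\<in>edges n. dangle pos (relabel n \<tau> \<Gamma>) (reflect_config n c p) e (\<sigma> e)) =
        (\<Prod>e\<in>edges n. \<epsilon> (\<sigma> e) * dangle pos \<Gamma> p e (\<sigma> e))"
    proof (rule prod.cong)
      fix e assume e: "e \<in> edges n"
      obtain l d where ld: "\<sigma> e = (l, d)" by (cases "\<sigma> e")
      have "(l, d) \<in> edges n" using permutes_in_image[OF that] e by (simp flip: ld)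
      then show "dangle pos (relabel n \<tau> \<Gamma>) (reflect_config n c p) e (\<sigma> e) =
          \<epsilon> (\<sigma> e) * dangle pos \<Gamma> p e (\<sigma> e)"
        unfolding ld using dangle_reflect[OF assms e, of l d] by (simp add: \<epsilon>_def del: dangle.simps)
    qed simp
    also have "\<dots> = (\<Prod>e\<in>edges n. \<epsilon> e) * (\<Prod>e\<in>edges n. dangle pos \<Gamma> p e (\<sigma> e))"
      by (simp add: prod.distrib prod.permute[OF that, of \<epsilon>] comp_def)
    finally show ?thesis by (simp only: prod_\<epsilon>)
  qed
  then show ?thesis
    by (simp add: wedge_coeff_def sum_distrib_left mult_ac)
qed

theorem weight_relabel:
  assumes "\<Gamma> \<in> graphs n"
  shows "weight pos n (relabel n \<tau> \<Gamma>) = (- 1) ^ n * weight pos n \<Gamma>"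
proof -
  let ?M = "Pi\<^sub>M {1..n} (\<lambda>_. lborel :: complex measure)"
  let ?g = "\<lambda>\<Gamma> p. indicator (configs pos n) p *\<^sub>R wedge_coeff pos n \<Gamma> p"
  have ext: "p \<in> extensional {1..n}" if "p \<in> space ?M" for p
    using that by (simp add: space_PiM PiE_iff)
  have "(\<integral>p. ?g (relabel n \<tau> \<Gamma>) p \<partial>?M) = (\<integral>p. ?g (relabel n \<tau> \<Gamma>) (reflect_config n c p) \<partial>?M)"
    by (rule integral_involution[symmetric, OF measurable_reflect_config distr_reflect_config
        reflect_config_reflect_config[OF ext]])
  \<comment> \<open>Both integrands vanish outside \<open>configs pos n\<close>, which the
    reflection preserves, so the determinant formula is applied only to configurations.\<close>
  also have "\<dots> = (\<integral>p. (- 1) ^ n * ?g \<Gamma> p \<partial>?M)"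
  proof (rule Bochner_Integration.integral_cong)
    fix p assume "p \<in> space ?M"
    then show "?g (relabel n \<tau> \<Gamma>) (reflect_config n c p) = (- 1) ^ n * ?g \<Gamma> p"
      using reflect_config_in_configs_iff[OF ext] wedge_coeff_reflect[OF assms, of p]
      by (cases "p \<in> configs pos n") auto
  qed simp
  also have "\<dots> = (- 1) ^ n * (\<integral>p. ?g \<Gamma> p \<partial>?M)" by (rule integral_mult_right_zero)
  finally show ?thesis by (simp add: weight_def set_lebesgue_integral_def)
qed

end

section \<open>Conjugation of polynomials\<close>

lemma lookup_poly_conj [simp]: "Poly_Mapping.lookup (poly_conj f) m = cnj (Poly_Mapping.lookup f m)"
  by (simp add: poly_conj_eq Poly_Mapping.map.rep_eq when_def)

lemma poly_conj_add: "poly_conj (f + g) = poly_conj f + poly_conj g"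
  by (rule poly_mapping_eqI) (simp add: lookup_add)

lemma poly_conj_zero [simp]: "poly_conj 0 = 0"
  by (rule poly_mapping_eqI) simp

lemma poly_conj_sum: "poly_conj (\<Sum>x\<in>X. F x) = (\<Sum>x\<in>X. poly_conj (F x))"
  by (induction X rule: infinite_finite_induct) (auto simp: poly_conj_add)

lemma poly_conj_single: "poly_conj (Poly_Mapping.single m a) = Poly_Mapping.single m (cnj a)"
  by (rule poly_mapping_eqI) (simp add: lookup_single when_def)

lemma poly_conj_pconst [simp]: "poly_conj (pconst a) = pconst (cnj a)"
  by (simp add: pconst_def poly_conj_single)

lemma poly_conj_poly_conj [simp]: "poly_conj (poly_conj f) = f"
  by (rule poly_mapping_eqI) simp

text \<open>With this expansion, identities for products reduce to single monomials.\<close>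

lemma sum_monomials: 
  "f = (\<Sum>m\<in>Poly_Mapping.keys f. Poly_Mapping.single m (Poly_Mapping.lookup f m))"
  by (rule poly_mapping_eqI) (auto simp: lookup_sum lookup_single when_def in_keys_iff)

lemma poly_conj_mult: "poly_conj (f * g) = poly_conj f * poly_conj g"
proof -
  let ?F = "\<lambda>f m. Poly_Mapping.single m (Poly_Mapping.lookup f m)"
  have "poly_conj (f * g) = poly_conj ((\<Sum>m\<in>Poly_Mapping.keys f. ?F f m) * (\<Sum>m\<in>Poly_Mapping.keys g. ?F g m))"
    by (simp flip: sum_monomials)
  also have "\<dots> = poly_conj (\<Sum>m\<in>Poly_Mapping.keys f. ?F f m) * poly_conj (\<Sum>m\<in>Poly_Mapping.keys g. ?F g m)"
    by (simp add: sum_product poly_conj_sum mult_single poly_conj_single)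
  finally show ?thesis by (simp flip: sum_monomials)
qed

lemma pconst_1 [simp]: "pconst 1 = 1"
  by (simp add: pconst_def)

lemma poly_conj_one [simp]: "poly_conj 1 = 1"
  using poly_conj_pconst[of 1] by simp

lemma poly_conj_prod: "poly_conj (\<Prod>x\<in>X. F x) = (\<Prod>x\<in>X. poly_conj (F x))"
  by (induction X rule: infinite_finite_induct) (auto simp: poly_conj_mult)

lemma pconst_mult: "pconst (a * b) = pconst a * pconst b"
  by (simp add: pconst_def mult_single)

lemma pconst_uminus: "pconst (- a) = - pconst a"
  by (simp add: pconst_def single_uminus)

lemma pconst_minus_one_power: "pconst ((- 1) ^ n) = (- 1) ^ n"
  by (induction n) (simp_all add: pconst_mult pconst_uminus)

lemma lookup_pconst_mult [simp]:
  "Poly_Mapping.lookup (pconst a * f) m = a * Poly_Mapping.lookup f m"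
proof -
  have "Poly_Mapping.lookup (pconst a * (\<Sum>k\<in>Poly_Mapping.keys f. Poly_Mapping.single k (Poly_Mapping.lookup f k))) m =
      a * Poly_Mapping.lookup (\<Sum>k\<in>Poly_Mapping.keys f. Poly_Mapping.single k (Poly_Mapping.lookup f k)) m"
    by (simp add: pconst_def sum_distrib_left mult_single lookup_sum lookup_single when_def if_distrib cong: if_cong)
  then show ?thesis by (simp flip: sum_monomials)
qed

lemma partial_poly_conj: "partial i (poly_conj f) = poly_conj (partial i f)"
  by (rule poly_mapping_eqI) (simp add: lookup_partial)

lemma partial_pconst_mult: "partial i (pconst a * f) = pconst a * partial i f"
  by (rule poly_mapping_eqI) (simp add: lookup_partial)

lemma partials_poly_conj:
  "finite E \<Longrightarrow> partials I E (poly_conj f) = poly_conj (partials I E f)"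
  by (induction E rule: finite_induct) (simp_all add: partials_insert partial_poly_conj)

lemma partials_pconst_mult:
  "finite E \<Longrightarrow> partials I E (pconst a * f) = pconst a * partials I E f"
  by (induction E rule: finite_induct) (simp_all add: partials_insert partial_pconst_mult)

section \<open>Symmetries of the graph operators\<close>

lemma finite_into [simp]: "finite (into n \<Gamma> v)"
  by (simp add: into_def)

text \<open>Conjugation is multiplicative and additive, commutes with partial derivatives and fixes
  the tensor, so it passes to the arguments.\<close>

lemma poly_conj_graph_op:
  fixes \<alpha> :: "'d::finite \<Rightarrow> 'd \<Rightarrow> 'd mpoly"
  assumes "\<And>i j. poly_conj (\<alpha> i j) = \<alpha> i j"
  shows "poly_conj (graph_op \<alpha> n \<Gamma> F) = graph_op \<alpha> n \<Gamma> (\<lambda>v. poly_conj (F v))"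
  by (simp add: graph_op_def poly_conj_sum poly_conj_mult poly_conj_prod assms
      flip: partials_poly_conj)

lemma graph_op_pconst_mult:
  "graph_op \<alpha> n \<Gamma> (\<lambda>v. pconst (a v) * F v) = (\<Prod>v\<in>UNIV. pconst (a v)) * graph_op \<alpha> n \<Gamma> F"
  unfolding graph_op_def partials_pconst_mult[OF finite_into] prod.distrib sum_distrib_left
  by (simp only: mult.left_commute)

lemma into_relabel:
  assumes "\<And>v. \<tau> (\<tau> v) = v"
  shows "into n (relabel n \<tau> \<Gamma>) (map_vertex \<tau> v) = into n \<Gamma> v"
  by (auto simp: into_def relabel_def dest: arg_cong[of _ _ "map_vertex \<tau>"]
      simp: map_vertex_involution[OF assms])

text \<open>The inner factors are unchanged; the product over the ground vertices is reindexed by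
  the bijection \<tau>.\<close>

lemma graph_op_relabel:
  assumes "\<And>v. \<tau> (\<tau> v) = v"
  shows "graph_op \<alpha> n (relabel n \<tau> \<Gamma>) F = graph_op \<alpha> n \<Gamma> (\<lambda>v. F (\<tau> v))"
proof -
  have inner: "into n (relabel n \<tau> \<Gamma>) (Inner k) = into n \<Gamma> (Inner k)" for k
    using into_relabel[of \<tau> n \<Gamma> "Inner k", OF assms] by simp
  have ground: "into n (relabel n \<tau> \<Gamma>) (Ground (\<tau> v)) = into n \<Gamma> (Ground v)" for v
    using into_relabel[of \<tau> n \<Gamma> "Ground v", OF assms] by simp
  have "bij \<tau>" using assms by (rule involuntory_imp_bij)
  then have "(\<Prod>v\<in>UNIV. partials I (into n (relabel n \<tau> \<Gamma>) (Ground v)) (F v)) =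
      (\<Prod>v\<in>UNIV. partials I (into n \<Gamma> (Ground v)) (F (\<tau> v)))" for I
    using prod.reindex_bij_betw[of \<tau> UNIV UNIV
        "\<lambda>v. partials I (into n (relabel n \<tau> \<Gamma>) (Ground v)) (F v)"]
    by (simp add: ground)
  then show ?thesis by (simp add: graph_op_def inner)
qed

section \<open>The two reflections and the parity of the coefficients\<close>

fun swap_side :: "side \<Rightarrow> side" where
  "swap_side LSide = RSide"
| "swap_side RSide = LSide"

lemma swap_side_swap_side [simp]: "swap_side (swap_side v) = v"
  by (cases v) auto

interpretation LR: ground_reflection pos_LR swap_side 1
proof
  fix v
  show "pos_LR (swap_side v) = reflect 1 (pos_LR v)" "0 \<le> Im (pos_LR v)"
    by (cases v; simp add: reflect_def)+
qed

interpretation ground_0: ground_reflection pos_0 id 0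
  by standard (simp_all add: pos_0_def reflect_def)

text \<open>The sum over graphs is reindexed by \<open>relabel n swap_side\<close>: the weights
  contribute the sign and the operators exchange their arguments.\<close>

lemma kontsevich_coeff_swap:
  "kontsevich_coeff \<alpha> n f g = (- 1) ^ n * kontsevich_coeff \<alpha> n g f"
proof -
  have "kontsevich_coeff \<alpha> n f g = (\<Sum>\<Gamma>\<in>graphs n.
      pconst (of_real (weight pos_LR n (relabel n swap_side \<Gamma>))) *
      graph_op \<alpha> n (relabel n swap_side \<Gamma>) (case_side f g))"
    unfolding kontsevich_coeff_def
    by (rule sum.reindex_bij_betw[symmetric]) (rule bij_betw_relabel, simp)
  also have "\<dots> = (\<Sum>\<Gamma>\<in>graphs n. (- 1) ^ n *
      (pconst (of_real (weight pos_LR n \<Gamma>)) * graph_op \<alpha> n \<Gamma> (case_side g f)))"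
  proof (rule sum.cong)
    fix \<Gamma> :: "nat \<times> nat \<Rightarrow> side vertex" assume "\<Gamma> \<in> graphs n"
    moreover have "(\<lambda>v. case_side f g (swap_side v)) = case_side g f"
      by (rule ext) (simp split: side.split add: swap_side.simps)
    ultimately show "pconst (of_real (weight pos_LR n (relabel n swap_side \<Gamma>))) *
        graph_op \<alpha> n (relabel n swap_side \<Gamma>) (case_side f g) =
        (- 1) ^ n * (pconst (of_real (weight pos_LR n \<Gamma>)) * graph_op \<alpha> n \<Gamma> (case_side g f))"
      by (simp add: LR.weight_relabel graph_op_relabel pconst_mult pconst_minus_one_power mult_ac)
  qed simp
  finally show ?thesis by (simp add: kontsevich_coeff_def sum_distrib_left)
qed

text \<open>The ground vertex is fixed, so each graph is its own relabelling and its weight is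
  \<open>(- 1) ^ n\<close> times itself. In this form the identity absorbs signs without a case
  distinction on n.\<close>

lemma tangent_coeff_parity: "tangent_coeff \<alpha> n f = (- 1) ^ n * tangent_coeff \<alpha> n f"
proof -
  have "weight pos_0 n \<Gamma> = (- 1) ^ n * weight pos_0 n \<Gamma>" if "\<Gamma> \<in> graphs n" for \<Gamma>
  proof -
    have "relabel n id \<Gamma> = \<Gamma>"
      using that by (auto simp: relabel_def vertex.map_id graphs_def fun_eq_iff PiE_iff extensional_def)
    then show ?thesis using ground_0.weight_relabel[OF that] by simp
  qed
  then have "tangent_coeff \<alpha> n f = (\<Sum>\<Gamma>\<in>graphs n.
      pconst (of_real ((- 1) ^ n * weight pos_0 n \<Gamma>)) * graph_op \<alpha> n \<Gamma> (\<lambda>_. f))"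
    unfolding tangent_coeff_def by (metis (no_types, lifting) sum.cong)
  then show ?thesis
    by (simp add: tangent_coeff_def pconst_mult pconst_minus_one_power sum_distrib_left mult.assoc)
qed

text \<open>Serves to pull the signs in the coefficients of \<open>series_conj\<close> out of the
  operators.\<close>

lemma kontsevich_coeff_minus_one_power:
  "kontsevich_coeff \<alpha> n ((- 1) ^ i * f) ((- 1) ^ j * g) = (- 1) ^ (i + j) * kontsevich_coeff \<alpha> n f g"
proof -
  have "case_side ((- 1) ^ i * f) ((- 1) ^ j * g) =
      (\<lambda>v. pconst (case_side ((- 1) ^ i) ((- 1) ^ j) v) * case_side f g v)"
    by (rule ext) (simp add: pconst_minus_one_power split: side.split)
  then have op: "graph_op \<alpha> n \<Gamma> (case_side ((- 1) ^ i * f) ((- 1) ^ j * g)) =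
      (- 1) ^ (i + j) * graph_op \<alpha> n \<Gamma> (case_side f g)" for \<Gamma>
    by (simp only: graph_op_pconst_mult)
      (simp add: UNIV_side pconst_minus_one_power power_add)
  show ?thesis
    unfolding kontsevich_coeff_def op sum_distrib_left by (simp only: mult.left_commute)
qed

lemma tangent_coeff_minus_one_power:
  "tangent_coeff \<alpha> n ((- 1) ^ i * f) = (- 1) ^ i * tangent_coeff \<alpha> n f"
proof -
  have op: "graph_op \<alpha> n \<Gamma> (\<lambda>_::unit. (- 1) ^ i * f) = (- 1) ^ i * graph_op \<alpha> n \<Gamma> (\<lambda>_. f)" for \<Gamma>
    using graph_op_pconst_mult[of \<alpha> n \<Gamma> "\<lambda>_::unit. (- 1) ^ i" "\<lambda>_. f"]
    by (simp add: UNIV_unit pconst_minus_one_power)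
  show ?thesis
    unfolding tangent_coeff_def op sum_distrib_left by (simp only: mult.left_commute)
qed

section \<open>Conjugation of power series\<close>

lemma series_conj_nth [simp]: "fps_nth (series_conj f) k = (- 1) ^ k * poly_conj (fps_nth f k)"
  by (simp add: series_conj_def)

lemma series_conj_series_conj [simp]: "series_conj (series_conj f) = f"
  by (rule fps_ext) (simp add: poly_conj_mult flip: pconst_minus_one_power mult.assoc pconst_mult power_add mult_2)

lemma series_conj_add: "series_conj (f + g) = series_conj f + series_conj g"
  by (rule fps_ext) (simp add: poly_conj_add algebra_simps)

text \<open>For the ordinary product of series; this yields semilinearity over scalar series and
  multiplicativity on A.\<close>

lemma series_conj_mult: "series_conj (f * g) = series_conj f * series_conj g"
proof (rule fps_ext)
  fix n
  have "(- 1) ^ n * poly_conj (fps_nth f i * fps_nth g (n - i)) =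
     (- 1) ^ i * poly_conj (fps_nth f i) * ((- 1) ^ (n - i) * poly_conj (fps_nth g (n - i)))"
    if "i \<le> n" for i
  proof -
    have "(- 1 :: 'a mpoly) ^ n = (- 1) ^ i * (- 1) ^ (n - i)"
      using that by (simp flip: power_add)
    then show ?thesis by (simp add: poly_conj_mult mult_ac)
  qed
  then show "fps_nth (series_conj (f * g)) n = fps_nth (series_conj f * series_conj g) n"
    by (simp add: fps_mult_nth poly_conj_sum sum_distrib_left)
qed

lemma series_conj_scalar_series: "series_conj (scalar_series a) = scalar_series (scalar_conj a)"
  by (rule fps_ext) (simp add: scalar_series_def scalar_conj_def pconst_mult pconst_minus_one_power)

lemma series_conj_fps_const [simp]: "series_conj (fps_const f) = fps_const (poly_conj f)"
  by (rule fps_ext) simp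

section \<open>Conjugation of the Kontsevich product and of the tangent map\<close>

locale real_tensor =
  fixes \<alpha> :: "'d::finite \<Rightarrow> 'd \<Rightarrow> 'd mpoly"
  assumes poly_conj_tensor: "poly_conj (\<alpha> i j) = \<alpha> i j"
begin

lemma poly_conj_kontsevich_coeff:
  "poly_conj (kontsevich_coeff \<alpha> n f g) = kontsevich_coeff \<alpha> n (poly_conj f) (poly_conj g)"
proof -
  have "(\<lambda>v. poly_conj (case_side f g v)) = case_side (poly_conj f) (poly_conj g)"
    by (rule ext) (simp split: side.split)
  then show ?thesis
    by (simp add: kontsevich_coeff_def poly_conj_sum poly_conj_mult
        poly_conj_graph_op poly_conj_tensor)
qed

lemma poly_conj_tangent_coeff: "poly_conj (tangent_coeff \<alpha> n f) = tangent_coeff \<alpha> n (poly_conj f)"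
  by (simp add: tangent_coeff_def poly_conj_sum poly_conj_mult poly_conj_graph_op poly_conj_tensor)

lemma series_conj_kontsevich_star:
  "series_conj (kontsevich_star \<alpha> f g) = kontsevich_star \<alpha> (series_conj g) (series_conj f)"
proof (rule fps_ext)
  fix N
  \<comment> \<open>The index i stays with f and j with g although the arguments are exchanged, so
    the double sum is transposed at the end.\<close>
  define K where "K i j = kontsevich_coeff \<alpha> (N - i - j)
    (fps_nth (series_conj g) j) (fps_nth (series_conj f) i)" for i j
  have K: "(- 1) ^ N * poly_conj (kontsevich_coeff \<alpha> (N - i - j) (fps_nth f i) (fps_nth g j)) = K i j"
    if "i \<le> N" "j \<le> N - i" for i j
  proof -
    let ?k = "kontsevich_coeff \<alpha> (N - i - j) (poly_conj (fps_nth g j)) (poly_conj (fps_nth f i))"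
    have "(- 1) ^ N * poly_conj (kontsevich_coeff \<alpha> (N - i - j) (fps_nth f i) (fps_nth g j)) =
        (- 1) ^ N * ((- 1) ^ (N - i - j) * ?k)"
      unfolding poly_conj_kontsevich_coeff by (subst kontsevich_coeff_swap) (rule refl)
    \<comment> \<open>Here N + (N - i - j) = i + j + 2 (N - i - j). The even part drops out, and
      \<open>(- 1) ^ (i + j)\<close> is the sign that \<open>series_conj\<close> puts on the two
      coefficients.\<close>
    also have "\<dots> = (- 1) ^ (i + j + 2 * (N - i - j)) * ?k"
      using that by (simp flip: power_add mult.assoc add: mult_2)
    also have "\<dots> = K i j"
      by (simp add: K_def kontsevich_coeff_minus_one_power power_add add.commute)
    finally show ?thesis .
  qed
  have "fps_nth (series_conj (kontsevich_star \<alpha> f g)) N = (\<Sum>i\<le>N. \<Sum>j\<le>N - i. K i j)"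
    using K by (simp add: kontsevich_star_def poly_conj_sum sum_distrib_left)
  \<comment> \<open>Both double sums run over the triangle i + j \<le> N.\<close>
  also have "\<dots> = (\<Sum>j\<le>N. \<Sum>i\<le>N - j. K i j)"
    unfolding sum.Sigma[OF finite_atMost ballI[OF finite_atMost]]
    by (rule sum.reindex_bij_witness[where i = prod.swap and j = prod.swap]) auto
  also have "\<dots> = fps_nth (kontsevich_star \<alpha> (series_conj g) (series_conj f)) N"
    by (simp add: kontsevich_star_def K_def add.commute)
  finally show "fps_nth (series_conj (kontsevich_star \<alpha> f g)) N =
      fps_nth (kontsevich_star \<alpha> (series_conj g) (series_conj f)) N" .
qed

lemma series_conj_tangent_map: "series_conj (tangent_map \<alpha> f) = tangent_map \<alpha> (series_conj f)"
proof (rule fps_ext)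
  fix N
  have "(- 1) ^ N * poly_conj (tangent_coeff \<alpha> (N - i) (fps_nth f i)) =
      tangent_coeff \<alpha> (N - i) (fps_nth (series_conj f) i)" if "i \<le> N" for i
  proof -
    let ?t = "tangent_coeff \<alpha> (N - i) (poly_conj (fps_nth f i))"
    \<comment> \<open>The factor \<open>(- 1) ^ (N - i)\<close> is absorbed by
      \<open>tangent_coeff_parity\<close>; \<open>(- 1) ^ i\<close> belongs to the coefficient of
      \<open>series_conj f\<close>.\<close>
    have "(- 1) ^ N * ?t = (- 1) ^ i * ((- 1) ^ (N - i) * ?t)"
      using that by (simp flip: mult.assoc power_add)
    then show ?thesis
      by (simp add: poly_conj_tangent_coeff tangent_coeff_minus_one_power
          flip: tangent_coeff_parity)
  qed
  then show "fps_nth (series_conj (tangent_map \<alpha> f)) N = fps_nth (tangent_map \<alpha> (series_conj f)) N"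
    by (simp add: tangent_map_def poly_conj_sum sum_distrib_left)
qed

end

section \<open>Invertibility of the tangent map\<close>

text \<open>Forward substitution for a lower triangular system with identity diagonal and entries
  \<open>t N i\<close> below it.\<close>

fun solve_unitriangular ::
  "(nat \<Rightarrow> nat \<Rightarrow> 'a \<Rightarrow> 'a) \<Rightarrow> (nat \<Rightarrow> 'a) \<Rightarrow> nat \<Rightarrow> 'a::ab_group_add" where
  "solve_unitriangular t g N = g N - (\<Sum>i<N. t N i (solve_unitriangular t g i))"

declare solve_unitriangular.simps [simp del]

text \<open>For no points the product measure is a point mass and the empty determinant is
  1.\<close>

lemma weight_0: "weight pos 0 (\<lambda>_. undefined) = 1"
proof -
  have "configs pos 0 = {\<lambda>_. undefined}" by (auto simp: configs_def)
  moreover have "wedge_coeff pos 0 \<Gamma> p = 1" for \<Gamma> p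
    by (simp add: wedge_coeff_def edges_def)
  ultimately show ?thesis
    by (simp add: weight_def PiM_empty set_lebesgue_integral_def lebesgue_integral_count_space_finite)
qed

lemma tangent_coeff_0: "tangent_coeff \<alpha> 0 f = f"
proof -
  have "graphs 0 = {\<lambda>_. undefined :: unit vertex}" by (auto simp: graphs_def edges_def)
  moreover have "graph_op \<alpha> 0 \<Gamma> (\<lambda>_::unit. f) = f" for \<Gamma>
    by (simp add: graph_op_def edges_def into_def UNIV_unit)
  ultimately show ?thesis by (simp add: tangent_coeff_def weight_0)
qed

lemma tangent_map_nth:
  "fps_nth (tangent_map \<alpha> f) N = fps_nth f N + (\<Sum>i<N. tangent_coeff \<alpha> (N - i) (fps_nth f i))"
  by (simp add: tangent_map_def tangent_coeff_0 flip: lessThan_Suc_atMost)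

text \<open>By degree in \<nu> the map is lower triangular with identity diagonal: induction gives
  injectivity, forward substitution surjectivity. Hence \<open>inv\<close> in the definition of the
  product is a genuine inverse.\<close>

lemma bij_tangent_map: "bij (tangent_map \<alpha>)"
proof (rule bijI)
  show "inj (tangent_map \<alpha>)"
  proof (rule injI, rule fps_ext)
    fix f g N assume eq: "tangent_map \<alpha> f = tangent_map \<alpha> g"
    show "fps_nth f N = fps_nth g N"
    proof (induction N rule: less_induct)
      case (less N)
      have "fps_nth f N + (\<Sum>i<N. tangent_coeff \<alpha> (N - i) (fps_nth f i)) =
          fps_nth g N + (\<Sum>i<N. tangent_coeff \<alpha> (N - i) (fps_nth g i))"
        using eq by (simp flip: tangent_map_nth)
      then show ?case using less by simp
    qed
  qed
  show "surj (tangent_map \<alpha>)"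
  proof (rule surjI, rule fps_ext)
    fix g N
    show "fps_nth (tangent_map \<alpha> (Abs_fps (solve_unitriangular
        (\<lambda>N i. tangent_coeff \<alpha> (N - i)) (fps_nth g)))) N = fps_nth g N"
      by (simp add: tangent_map_nth solve_unitriangular.simps[of _ _ N])
  qed
qed

section \<open>The involution on the Duflo-Kontsevich algebra\<close>

context real_tensor
begin

text \<open>Conjugation commutes with the tangent map, hence with its inverse.\<close>

lemma series_conj_inv_tangent_map:
  "series_conj (inv (tangent_map \<alpha>) f) = inv (tangent_map \<alpha>) (series_conj f)"
proof -
  have "tangent_map \<alpha> (inv (tangent_map \<alpha>) f) = f"
    by (simp add: bij_is_surj bij_tangent_map surj_f_inv_f)
  then have "tangent_map \<alpha> (series_conj (inv (tangent_map \<alpha>) f)) = series_conj f"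
    by (simp flip: series_conj_tangent_map)
  then show ?thesis by (metis bij_is_inj bij_tangent_map inv_f_f)
qed

lemma series_conj_duflo_kontsevich_star:
  "series_conj (duflo_kontsevich_star \<alpha> f g) =
   duflo_kontsevich_star \<alpha> (series_conj g) (series_conj f)"
  by (simp add: duflo_kontsevich_star_def series_conj_inv_tangent_map
      series_conj_kontsevich_star series_conj_tangent_map)

end

lemma real_tensor_half_tensor:
  assumes "real_poisson_bracket br"
  shows "real_tensor (half_tensor br)"
proof
  fix i j
  have "poly_conj (br (pvar i) (pvar j)) = br (pvar i) (pvar j)"
    using assms by (intro poly_mapping_eqI)
      (simp add: real_poisson_bracket_def real_coeffs_def Reals_cnj_iff)
  then show "poly_conj (half_tensor br i j) = half_tensor br i j"
    by (simp add: half_tensor_def poly_conj_mult)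
qed

theorem propositionI6p2:
  fixes br :: "'d::finite mpoly \<Rightarrow> 'd mpoly \<Rightarrow> 'd mpoly"
  assumes "real_poisson_bracket br"
  shows "(\<forall>f g :: 'd mpoly fps. series_conj (f + g) = series_conj f + series_conj g) \<and>
    (\<forall>c (f :: 'd mpoly fps).
       series_conj (scalar_series c * f) = scalar_series (scalar_conj c) * series_conj f) \<and>
    (\<forall>f :: 'd mpoly fps. series_conj (series_conj f) = f) \<and>
    (\<forall>f g. series_conj (duflo_kontsevich_star (half_tensor br) f g) =
       duflo_kontsevich_star (half_tensor br) (series_conj g) (series_conj f)) \<and>
    bij_betw series_conj const_series (const_series :: 'd mpoly fps set) \<and>
    (\<forall>f\<in>const_series. \<forall>g\<in>const_series.
       series_conj (f + g) = series_conj f + (series_conj g :: 'd mpoly fps)) \<and>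
    (\<forall>c. \<forall>f\<in>const_series.
       series_conj (fps_const (pconst c) * f) =
       fps_const (pconst (cnj c)) * (series_conj f :: 'd mpoly fps)) \<and>
    (\<forall>f\<in>const_series. \<forall>g\<in>const_series.
       series_conj (f * g) = series_conj g * (series_conj f :: 'd mpoly fps))"
proof -
  interpret real_tensor "half_tensor br"
    using assms by (rule real_tensor_half_tensor)
  have "bij_betw series_conj const_series (const_series :: 'd mpoly fps set)"
    by (rule bij_betw_byWitness[where f' = series_conj]) (auto simp: const_series_def)
  \<comment> \<open>The product on A is commutative, so multiplicativity also gives the reversed
    order.\<close>
  then show ?thesis
    by (intro conjI allI ballI)
      (simp_all only: series_conj_add series_conj_mult series_conj_scalar_series
        series_conj_series_conj series_conj_duflo_kontsevich_star series_conj_fps_const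
        poly_conj_pconst mult.commute)
qed

end
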